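(* No finite cyclic group has the NNN-property. That is, if $G$ is a finite cyclic group, then there is no Cayley graph $\Gamma=\mathrm{Cay}(G,S)$ which is an NNN-graph for $G$.
   Context: For a finite group $G$ and a subset $S\subseteq G$ with $1\notin S$ and $S=S^{-1}$, the Cayley graph $\mathrm{Cay}(G,S)$ is the graph with vertex set $G$ and edge set $\{\{g,sg\}\mid g\in G,\ s\in S\}$. For $g\in G$ let $g_R:x\mapsto xg$; the group $G_R=\{g_R\mid g\in G\}$ is a regular subgroup of $\mathrm{Aut}(\Gamma)$. The graph $\Gamma=\mathrm{Cay}(G,S)$ is normal for $G$ if $G_R\unlhd \mathrm{Aut}(\Gamma)$. More generally, if $H\leqslant\mathrm{Aut}(\Gamma)$ is a subgroup acting regularly on the vertices, then $\Gamma$ is normal for $H$ if $H\unlhd\mathrm{Aut}(\Gamma)$ and non-normal for $H$ otherwise. $\Gamma=\mathrm{Cay}(G,S)$ is an NNN-graph for $G$ if it is normal for $G$ (that is, $G_R\unlhd\mathrm{Aut}(\Gamma)$) and $\mathrm{Aut}(\Gamma)$ contains a regular subgroup $H\cong G$, $H\neq G_R$, such that $\Gamma$ is non-normal for $H$. The group $G$ has the NNN-property if there exists an NNN-graph for $G$. *)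

theory Defs
  imports "HOL-Algebra.Algebra"
begin

text \<open>A simple undirected graph is a pair of a vertex set and a set of two-element edges.\<close>

type_synonym 'a ugraph = "'a set \<times> 'a set set"

definition connection_set :: "('a, 'b) monoid_scheme \<Rightarrow> 'a set \<Rightarrow> bool" where
  "connection_set G S \<longleftrightarrow>
     S \<subseteq> carrier G \<and> \<one>\<^bsub>G\<^esub> \<notin> S \<and> S = set_inv\<^bsub>G\<^esub> S"

definition Cay :: "('a, 'b) monoid_scheme \<Rightarrow> 'a set \<Rightarrow> 'a ugraph" where
  "Cay G S = (carrier G, {{g, s \<otimes>\<^bsub>G\<^esub> g} | g s. g \<in> carrier G \<and> s \<in> S})"

text \<open>As in \<^const>\<open>BijGroup\<close>, permutations of a vertex set are represented by extensional
  functions, so that distinct elements of the automorphism group are distinct permutations.\<close>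

definition graph_auts :: "'a ugraph \<Rightarrow> ('a \<Rightarrow> 'a) set" where
  "graph_auts \<Gamma> = {f \<in> Bij (fst \<Gamma>).
     \<forall>x \<in> fst \<Gamma>. \<forall>y \<in> fst \<Gamma>. {x, y} \<in> snd \<Gamma> \<longleftrightarrow> {f x, f y} \<in> snd \<Gamma>}"

definition Aut :: "'a ugraph \<Rightarrow> ('a \<Rightarrow> 'a) monoid" where
  "Aut \<Gamma> = BijGroup (fst \<Gamma>)\<lparr>carrier := graph_auts \<Gamma>\<rparr>"

definition right_regular :: "('a, 'b) monoid_scheme \<Rightarrow> ('a \<Rightarrow> 'a) set" where
  "right_regular G = (\<lambda>g. \<lambda>x \<in> carrier G. x \<otimes>\<^bsub>G\<^esub> g) ` carrier G"

text \<open>A regular subgroup acts transitively on the vertices with trivial stabilizers.\<close>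

definition regular_subgroup :: "('a \<Rightarrow> 'a) set \<Rightarrow> 'a ugraph \<Rightarrow> bool" where
  "regular_subgroup H \<Gamma> \<longleftrightarrow>
     subgroup H (Aut \<Gamma>) \<and>
     transitive_action (Aut \<Gamma>\<lparr>carrier := H\<rparr>) (fst \<Gamma>) (\<lambda>h. h) \<and>
     (\<forall>x \<in> fst \<Gamma>. stabilizer (Aut \<Gamma>\<lparr>carrier := H\<rparr>) (\<lambda>h. h) x = {\<one>\<^bsub>Aut \<Gamma>\<^esub>})"

definition normal_for :: "('a \<Rightarrow> 'a) set \<Rightarrow> 'a ugraph \<Rightarrow> bool" where
  "normal_for H \<Gamma> \<longleftrightarrow> regular_subgroup H \<Gamma> \<and> H \<lhd> Aut \<Gamma>"

definition non_normal_for :: "('a \<Rightarrow> 'a) set \<Rightarrow> 'a ugraph \<Rightarrow> bool" where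
  "non_normal_for H \<Gamma> \<longleftrightarrow> regular_subgroup H \<Gamma> \<and> \<not> H \<lhd> Aut \<Gamma>"

definition NNN_graph :: "('a, 'b) monoid_scheme \<Rightarrow> 'a ugraph \<Rightarrow> bool" where
  "NNN_graph G \<Gamma> \<longleftrightarrow>
     (\<exists>S. connection_set G S \<and> \<Gamma> = Cay G S) \<and>
     normal_for (right_regular G) \<Gamma> \<and>
     (\<exists>H. Aut \<Gamma>\<lparr>carrier := H\<rparr> \<cong> G \<and> H \<noteq> right_regular G \<and> non_normal_for H \<Gamma>)"

definition NNN_property :: "('a, 'b) monoid_scheme \<Rightarrow> bool" where
  "NNN_property G \<longleftrightarrow> (\<exists>\<Gamma>. NNN_graph G \<Gamma>)"

lemma subgroup_graph_auts: "subgroup (graph_auts \<Gamma>) (BijGroup (fst \<Gamma>))"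
proof (rule group.subgroupI[OF group_BijGroup])
  let ?V = "fst \<Gamma>"
  show "graph_auts \<Gamma> \<subseteq> carrier (BijGroup ?V)"
    by (auto simp: graph_auts_def BijGroup_def)
  have "(\<lambda>x\<in>?V. x) \<in> graph_auts \<Gamma>"
    by (auto simp: graph_auts_def id_Bij)
  then show "graph_auts \<Gamma> \<noteq> {}" by blast
next
  let ?V = "fst \<Gamma>"
  fix f assume f: "f \<in> graph_auts \<Gamma>"
  then have fB: "f \<in> Bij ?V" by (simp add: graph_auts_def)
  let ?i = "\<lambda>x\<in>?V. inv_into ?V f x"
  have inv: "inv\<^bsub>BijGroup ?V\<^esub> f = ?i" by (rule inv_BijGroup[OF fB])
  have mem: "inv_into ?V f x \<in> ?V" "f (inv_into ?V f x) = x" if "x \<in> ?V" for x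
    using that fB Bij_inv_into_mem[OF fB that]
    by (auto simp: Bij_def bij_betw_def f_inv_into_f)
  have "{x, y} \<in> snd \<Gamma> \<longleftrightarrow> {?i x, ?i y} \<in> snd \<Gamma>" if "x \<in> ?V" "y \<in> ?V" for x y
    using f mem[OF that(1)] mem[OF that(2)] that unfolding graph_auts_def by auto
  then show "inv\<^bsub>BijGroup ?V\<^esub> f \<in> graph_auts \<Gamma>"
    using restrict_inv_into_Bij[OF fB] by (simp add: inv graph_auts_def)
next
  let ?V = "fst \<Gamma>"
  fix f g assume f: "f \<in> graph_auts \<Gamma>" and g: "g \<in> graph_auts \<Gamma>"
  then have B: "f \<in> Bij ?V" "g \<in> Bij ?V" by (simp_all add: graph_auts_def)
  have "g x \<in> ?V" if "x \<in> ?V" for x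
    using B that Bij_imp_funcset by blast
  then have "compose ?V f g \<in> graph_auts \<Gamma>"
    using f g compose_Bij[OF B] by (simp add: graph_auts_def compose_eq)
  then show "f \<otimes>\<^bsub>BijGroup ?V\<^esub> g \<in> graph_auts \<Gamma>"
    using B by (simp add: BijGroup_def)
qed

lemma group_Aut: "group (Aut \<Gamma>)"
  unfolding Aut_def
  by (rule subgroup.subgroup_is_group[OF subgroup_graph_auts group_BijGroup])

end

theory Submission
  imports Defs
begin

text \<open>Write the group additively as the integers modulo \<open>n\<close>. Normality of the right regular
  representation forces every automorphism of the graph to be affine. A cyclic regular subgroup \<open>H\<close> is
  generated by some \<open>x \<mapsto> u * x + b\<close> which is an \<open>n\<close>-cycle, so by Hull and Dobell \<open>u\<close> is \<open>1\<close> modulo every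
  prime divisor of \<open>n\<close>, and modulo \<open>4\<close> if \<open>4\<close> divides \<open>n\<close>. If \<open>u\<^sup>2 \<noteq> 1\<close>, some power of \<open>u\<close> has order
  \<open>q\<close> with \<open>q\<close> an odd prime or \<open>4\<close>; the connection set is stable under it, which makes the graph
  a generalized wreath product and produces an automorphism that is not affine. If \<open>u\<^sup>2 = 1\<close>, then
  either \<open>u = 1\<close> and \<open>H\<close> is the right regular representation, or \<open>4\<close> divides \<open>n\<close> and a parity
  argument shows that \<open>H\<close> is normal.\<close>

section \<open>Multipliers congruent to one\<close>

hide_const (open) Divisibility.prime

text \<open>The condition of Hull and Dobell on the multiplier of a linear congruential generator of full
  period modulo \<open>n\<close>.\<close>

definition hull_dobell :: "int \<Rightarrow> int \<Rightarrow> bool" where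
  "hull_dobell n u \<longleftrightarrow> (\<forall>r. prime r \<longrightarrow> r dvd n \<longrightarrow> r dvd u - 1) \<and> (4 dvd n \<longrightarrow> 4 dvd u - 1)"

lemma hull_dobell_power: "hull_dobell n u \<Longrightarrow> hull_dobell n (u ^ k)"
proof -
  have "u - 1 dvd u ^ k - 1"
    by (metis dvd_triv_left power_diff_1_eq)
  then show "hull_dobell n u \<Longrightarrow> hull_dobell n (u ^ k)"
    unfolding hull_dobell_def using dvd_trans by blast
qed

lemma coprime_int_primeI:
  fixes a n :: int
  assumes "n \<noteq> 0" "\<And>r. prime r \<Longrightarrow> r dvd n \<Longrightarrow> r dvd a \<Longrightarrow> False"
  shows "coprime n a"
proof (rule ccontr)
  assume "\<not> coprime n a"
  then have "\<not> is_unit (gcd n a)" by (simp add: coprime_iff_gcd_eq_1)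
  moreover have "gcd n a \<noteq> 0" using assms(1) by simp
  ultimately obtain r where "prime r" "r dvd gcd n a" using prime_divisor_exists by blast
  then show False using assms(2) by auto
qed

text \<open>Expansion is kept to second order: the coefficient \<open>k choose 2\<close> supplies a
  further factor \<open>p\<close> when \<open>k\<close> is an odd prime \<open>p\<close>, and the
  tail carries \<open>e ^ 3\<close>.\<close>

lemma binomial_cubic:
  fixes e :: "'a::comm_ring_1"
  shows "\<exists>Y. (1 + e) ^ k = 1 + of_nat k * e + of_nat (k choose 2) * e\<^sup>2 + e ^ 3 * Y"
proof (induction k)
  case 0
  show ?case by (rule exI[of _ 0]) (simp add: numeral_2_eq_2)
next
  case (Suc k)
  then obtain Y where Y: "(1 + e) ^ k = 1 + of_nat k * e + of_nat (k choose 2) * e\<^sup>2 + e ^ 3 * Y" ..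
  have "Suc k choose 2 = k + (k choose 2)" by (simp add: numeral_2_eq_2)
  then have "(1 + e) ^ Suc k = 1 + of_nat (Suc k) * e + of_nat (Suc k choose 2) * e\<^sup>2
      + e ^ 3 * (of_nat (k choose 2) + Y * (1 + e))"
    by (simp add: Y algebra_simps power2_eq_square power3_eq_cube)
  then show ?case ..
qed

text \<open>With \<open>e = v - 1\<close>, the binomial expansion writes \<open>v ^ p - 1\<close> as
  \<open>e\<close> or \<open>p * e\<close> times a cofactor. Every prime divisor of \<open>n\<close>
  divides \<open>e\<close>, which forces the cofactor to be coprime to \<open>n\<close>, so it can
  be cancelled.\<close>

lemma hull_dobell_root_odd_prime:
  fixes n v :: int
  assumes n: "n \<noteq> 0" and v: "hull_dobell n v" and p: "prime p" "odd p"
    and dvd: "n dvd v ^ p - 1"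
  shows "n dvd int p * (v - 1)" and "\<not> n dvd v - 1 \<Longrightarrow> int p dvd n"
proof -
  define e where "e = v - 1"
  have e: "r dvd e" if "prime r" "r dvd n" for r
    using v that by (auto simp: hull_dobell_def e_def)
  obtain Y where Y: "(1 + e) ^ p = 1 + int p * e + int (p choose 2) * e\<^sup>2 + e ^ 3 * Y"
    using binomial_cubic[of e p] by auto
  have step: "n dvd e" if "\<not> int p dvd n"
  proof -
    \<comment> \<open>A prime divisor of \<open>n\<close> dividing the second factor would divide
      \<open>p\<close>, hence equal \<open>p\<close>, which does not divide \<open>n\<close>
      here.\<close>
    have "v ^ p - 1 = e * (int p + e * (int (p choose 2) + e * Y))"
      using Y by (simp add: e_def algebra_simps power2_eq_square power3_eq_cube)
    moreover have "coprime n (int p + e * (int (p choose 2) + e * Y))"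
    proof (rule coprime_int_primeI[OF n])
      fix r assume r: "prime r" "r dvd n" "r dvd int p + e * (int (p choose 2) + e * Y)"
      then have "r dvd int p" using e[of r] by (simp add: dvd_add_left_iff)
      then have "r = int p" using r(1) p(1) by (simp add: primes_dvd_imp_eq)
      then show False using that r(2) by simp
    qed
    ultimately show ?thesis using dvd by (simp add: coprime_dvd_mult_left_iff)
  qed
  then show "\<not> n dvd v - 1 \<Longrightarrow> int p dvd n" by (auto simp: e_def)
  show "n dvd int p * (v - 1)"
  proof (cases "int p dvd n")
    case True
    then have "int p dvd e" using e p by simp
    then obtain f where f: "e = int p * f" ..
    obtain c where c: "p = 2 * c + 1" using p(2) by (auto elim: oddE)
    have v_eq: "v = 1 + e" by (simp add: e_def)
    \<comment> \<open>Oddness of \<open>p\<close> enters here: \<open>p\<close> divides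
      \<open>p choose 2\<close>, so \<open>p * e\<close> splits off from all terms.\<close>
    have "p choose 2 = p * c" unfolding c by (simp add: choose_two)
    then have ch: "int (p choose 2) = int p * int c" by simp
    have "v ^ p - 1 = (int p * e) * (1 + e * (int c + f * Y))"
      using Y ch v_eq by (simp add: algebra_simps power2_eq_square power3_eq_cube f)
    moreover have "coprime n (1 + e * (int c + f * Y))"
    proof (rule coprime_int_primeI[OF n])
      fix r assume r: "prime r" "r dvd n" "r dvd 1 + e * (int c + f * Y)"
      then have "r dvd 1" using e[of r] by (simp add: dvd_add_left_iff)
      then show False using r(1) not_prime_unit by blast
    qed
    ultimately show ?thesis using dvd by (simp add: coprime_dvd_mult_left_iff e_def)
  next
    case False
    then show ?thesis using step by (simp add: e_def)
  qed
qed

text \<open>In \<open>v\<^sup>2 - 1 = e * (e + 2)\<close> with \<open>e = v - 1\<close>, only the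
  prime 2 can divide both \<open>n\<close> and \<open>e + 2\<close>. If 4 divides \<open>n\<close>,
  then it divides \<open>e\<close>, so \<open>e + 2\<close> is twice an odd number and costs exactly
  one factor 2.\<close>

lemma hull_dobell_square:
  fixes n v :: int
  assumes n: "n \<noteq> 0" and v: "hull_dobell n v" and dvd: "n dvd v\<^sup>2 - 1"
  shows "n dvd 2 * (v - 1)" and "\<not> 4 dvd n \<Longrightarrow> n dvd v - 1"
proof -
  define e where "e = v - 1"
  have e: "r dvd e" if "prime r" "r dvd n" for r
    using v that by (auto simp: hull_dobell_def e_def)
  have fac: "n dvd e * (e + 2)" using dvd by (simp add: e_def algebra_simps power2_eq_square)
  have step: "n dvd e" if n4: "\<not> 4 dvd n"
  proof (cases "even n")
    case False
    have "coprime n (e + 2)"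
    proof (rule coprime_int_primeI[OF n])
      fix r assume r: "prime r" "r dvd n" "r dvd e + 2"
      then have "r dvd 2" using e[of r] by (simp add: dvd_add_right_iff)
      then have "r = 2" using r(1) by (simp add: primes_dvd_imp_eq)
      then show False using False r(2) by simp
    qed
    then show ?thesis using fac by (simp add: coprime_dvd_mult_left_iff)
  next
    case True
    then obtain m where m: "n = 2 * m" ..
    have odd: "odd m" using n4 m by auto
    have "coprime m (e + 2)"
    proof (rule coprime_int_primeI)
      show "m \<noteq> 0" using n m by simp
      fix r assume r: "prime r" "r dvd m" "r dvd e + 2"
      then have "r dvd 2" using e[of r] m by (simp add: dvd_add_right_iff)
      then have "r = 2" using r(1) by (simp add: primes_dvd_imp_eq)
      then show False using odd r(2) by simp
    qed
    then have "m dvd e" using fac m by (metis coprime_dvd_mult_left_iff dvd_mult_right)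
    moreover have "2 dvd e" using e[of 2] True by simp
    moreover have "coprime 2 m" using odd by simp
    ultimately show ?thesis unfolding m by (simp add: divides_mult)
  qed
  then show "\<not> 4 dvd n \<Longrightarrow> n dvd v - 1" by (simp add: e_def)
  show "n dvd 2 * (v - 1)"
  proof (cases "4 dvd n")
    case True
    then have "4 dvd e" using v by (simp add: hull_dobell_def e_def)
    then obtain a where a: "e = 4 * a" ..
    have "coprime n (1 + 2 * a)"
    proof (rule coprime_int_primeI[OF n])
      fix r assume r: "prime r" "r dvd n" "r dvd 1 + 2 * a"
      then have "r dvd 2 * (1 + 2 * a) - 4 * a" using e[of r] a by (metis dvd_diff dvd_mult)
      then have "r dvd 2" by (simp add: algebra_simps)
      then have "r = 2" using r(1) by (simp add: primes_dvd_imp_eq)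
      then show False using r(3) by simp
    qed
    moreover have "e * (e + 2) = 2 * e * (1 + 2 * a)" by (simp add: a algebra_simps)
    ultimately show ?thesis using fac by (simp add: coprime_dvd_mult_left_iff e_def)
  next
    case False
    then show ?thesis using step unfolding e_def[symmetric] by simp
  qed
qed

text \<open>The square case applied to \<open>v\<^sup>2\<close> gives both claims, once
  \<open>2 * (v\<^sup>2 - 1)\<close> is seen to be \<open>4 * (v - 1)\<close> times a number coprime
  to \<open>n\<close>.\<close>

lemma hull_dobell_fourth_power:
  fixes n v :: int
  assumes n: "n \<noteq> 0" and v: "hull_dobell n v" and dvd: "n dvd v ^ 4 - 1"
    and nd: "\<not> n dvd v\<^sup>2 - 1"
  shows "4 dvd n" and "n dvd 4 * (v - 1)"
proof -
  have v2: "hull_dobell n (v\<^sup>2)" using v by (rule hull_dobell_power)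
  have "n dvd (v\<^sup>2)\<^sup>2 - 1" using dvd by simp
  note sq = hull_dobell_square[OF n v2 this]
  show n4: "4 dvd n" using sq(2) nd by blast
  then obtain a where a: "v - 1 = 4 * a" using v by (auto simp: hull_dobell_def)
  then have va: "v = 1 + 4 * a" by simp
  have "coprime n (1 + 2 * a)"
  proof (rule coprime_int_primeI[OF n])
    fix r assume r: "prime r" "r dvd n" "r dvd 1 + 2 * a"
    have "r dvd 4 * a" using v r a by (metis hull_dobell_def)
    then have "r dvd 2 * (1 + 2 * a) - 4 * a" using r by (metis dvd_diff dvd_mult)
    then have "r dvd 2" by (simp add: algebra_simps)
    then have "r = 2" using r(1) by (simp add: primes_dvd_imp_eq)
    then show False using r(3) by simp
  qed
  moreover have "2 * (v\<^sup>2 - 1) = 4 * (v - 1) * (1 + 2 * a)"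
    by (simp add: va algebra_simps power2_eq_square)
  ultimately show "n dvd 4 * (v - 1)" using sq(1) by (simp add: coprime_dvd_mult_left_iff)
qed

text \<open>Descent on the exponent \<open>M\<close>: divide by an odd prime factor, or halve when
  \<open>M\<close> is a power of 2, until the shorter power of \<open>u\<close> is no longer 1
  modulo \<open>n\<close>. The values 1 and 2 of \<open>M\<close> are excluded by the third
  assumption.\<close>

lemma power_of_prime_order:
  fixes n u :: int
  assumes "M > 0" "n dvd u ^ M - 1" "\<not> n dvd u\<^sup>2 - 1"
  obtains j p where "prime p" "odd p" "n dvd (u ^ j) ^ p - 1" "\<not> n dvd u ^ j - 1"
  | j where "n dvd (u ^ j) ^ 4 - 1" "\<not> n dvd (u ^ j)\<^sup>2 - 1"
proof -
  have "(\<exists>j p. prime p \<and> odd p \<and> n dvd (u ^ j) ^ p - 1 \<and> \<not> n dvd u ^ j - 1) \<or>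
    (\<exists>j. n dvd (u ^ j) ^ 4 - 1 \<and> \<not> n dvd (u ^ j)\<^sup>2 - 1)"
    using assms(1,2)
  proof (induction M rule: less_induct)
    case (less M)
    have M: "M \<noteq> 1" "M \<noteq> 2"
      using less.prems assms(3) dvd_trans[of n "u - 1" "u\<^sup>2 - 1"]
      by (auto simp: power2_eq_square square_diff_one_factored)
    show ?case
    proof (cases "\<exists>p. prime p \<and> odd p \<and> p dvd M")
      case True
      then obtain p j where p: "prime p" "odd p" and M: "M = j * p" by (auto elim: dvdE)
      have "j < M" "j > 0" using less.prems(1) M p(1) prime_gt_1_nat by auto
      then show ?thesis using less.IH[of j] less.prems(2) p M by (auto simp: power_mult)
    next
      case False
      have "4 dvd M"
      proof -
        obtain p where "prime p" "p dvd M" using M(1) prime_factor_nat by blast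
        then have "even M" using False dvd_trans by blast
        then obtain c where c: "M = 2 * c" ..
        then have "c \<noteq> 1" using M(2) by simp
        then obtain p where "prime p" "p dvd c" using prime_factor_nat by blast
        then have "even c" using False c by (meson dvd_mult dvd_trans)
        then show ?thesis using c by auto
      qed
      then obtain j where j: "M = j * 4" by (auto elim: dvdE)
      have "2 * j < M" "2 * j > 0" using less.prems(1) j by auto
      then show ?thesis using less.IH[of "2 * j"] less.prems(2) j
        by (auto simp: power_mult mult.commute[of 2])
    qed
  qed
  then show thesis using that by blast
qed

lemma power_dvd_linear:
  fixes n e :: int
  assumes "n dvd e * e"
  shows "n dvd (1 + e) ^ k - (1 + int k * e)"
proof -
  obtain Y where "(1 + e) ^ k = 1 + int k * e + int (k choose 2) * e\<^sup>2 + e ^ 3 * Y"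
    using binomial_cubic[of e k] by auto
  then have "(1 + e) ^ k - (1 + int k * e) = e * e * (int (k choose 2) + e * Y)"
    by (simp add: algebra_simps power2_eq_square power3_eq_cube)
  then show ?thesis using assms by simp
qed

text \<open>Some power \<open>1 + e\<close> of \<open>u\<close> satisfies
  \<open>e\<^sup>2 = 0\<close> modulo \<open>n\<close>, so its powers act on \<open>z\<close> as
  \<open>z + i * z * e\<close>. Since \<open>q * e = 0\<close> modulo \<open>n\<close>, only
  \<open>i * z\<close> modulo \<open>q\<close> matters. A set stable under multiplication by
  \<open>u\<close> is thus stable under translation by \<open>t\<close> off the multiples of
  \<open>q\<close>.\<close>

lemma hull_dobell_orbits:
  fixes n u :: int
  assumes n: "n \<noteq> 0" and u: "hull_dobell n u" and M: "M > 0" "n dvd u ^ M - 1"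
    and nd: "\<not> n dvd u\<^sup>2 - 1"
  obtains q t where "3 \<le> q" "q dvd n" "q dvd t" "\<not> n dvd t"
    "\<And>z. \<not> q dvd z \<Longrightarrow> \<exists>k::nat. n dvd u ^ k * z - (z + t)"
proof -
  have red: "\<exists>k. n dvd u ^ k * z - (z + t)"
    if "n dvd e * e" "u ^ j = 1 + e" "n dvd int i * z * e - t" for z t e i j
  proof
    have "n dvd ((1 + e) ^ i - (1 + int i * e)) * z + (int i * z * e - t)"
      by (intro dvd_add dvd_mult2 power_dvd_linear that)
    also have "\<dots> = u ^ (j * i) * z - (z + t)"
      by (simp only: power_mult that(2)) (simp add: algebra_simps)
    finally show "n dvd u ^ (j * i) * z - (z + t)" .
  qed
  from M nd show thesis
  proof (cases rule: power_of_prime_order)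
    case (1 j p)
    define e where "e = u ^ j - 1"
    have v: "hull_dobell n (u ^ j)" using u by (rule hull_dobell_power)
    have pn: "int p dvd n" and pe: "n dvd int p * e"
      using hull_dobell_root_odd_prime[OF n v 1(1-3)] 1(4) by (auto simp: e_def)
    have pe': "int p dvd e" using v pn 1(1) by (auto simp: hull_dobell_def e_def)
    have ee: "n dvd e * e" using pe pe' by (meson dvd_refl dvd_trans mult_dvd_mono)
    show thesis
    proof (rule that[of "int p" e])
      show "3 \<le> int p" using 1(1,2) prime_ge_2_nat[of p] by (cases "p = 2") auto
      fix z assume z: "\<not> int p dvd z"
      then have "coprime (int p) z" using 1(1) by (simp add: prime_imp_coprime)
      then obtain x y where xy: "x * int p + y * z = 1"
        using bezout_int[of "int p" z] by auto
      \<comment> \<open>The Bezout coefficient \<open>y\<close> inverts \<open>z\<close> modulo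
        \<open>p\<close>; reducing it modulo \<open>p\<close> makes it a legitimate natural
        exponent.\<close>
      define i where "i = nat (y mod int p)"
      have i: "int i = y mod int p" using 1(1) prime_gt_0_nat by (simp add: i_def)
      have "y = y div int p * int p + int i" by (simp add: i)
      then have "int i * z - 1 = int p * (- x - y div int p * z)"
        using xy by (simp add: algebra_simps) (metis distrib_left mult.commute add.assoc add.commute)
      then have "int i * z * e - e = (int p * e) * (- x - y div int p * z)"
        by (metis (no_types, opaque_lifting) left_diff_distrib mult.assoc mult.commute mult_1)
      then have "n dvd int i * z * e - e" using pe by simp
      then show "\<exists>k. n dvd u ^ k * z - (z + e)" by (intro red[OF ee]) (simp_all add: e_def)
    qed (use pn pe' 1 in \<open>auto simp: e_def\<close>)
  next
    case (2 j)
    define e where "e = u ^ j - 1"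
    have v: "hull_dobell n (u ^ j)" using u by (rule hull_dobell_power)
    have n4: "4 dvd n" and e4: "n dvd 4 * e"
      using hull_dobell_fourth_power[OF n v 2] by (auto simp: e_def)
    have e4': "4 dvd e" using v n4 by (auto simp: hull_dobell_def e_def)
    have ee: "n dvd e * e" using e4 e4' by (meson dvd_refl dvd_trans mult_dvd_mono)
    show thesis
    \<comment> \<open>Translation by \<open>e\<close> itself is out of reach for \<open>z\<close>
      congruent to 2 modulo 4, but \<open>2 * e\<close> is reached by \<open>i = 1\<close> for such
      \<open>z\<close> and by \<open>i = 2\<close> for odd \<open>z\<close>.\<close>
    proof (rule that[of 4 "2 * e"])
      have "(u ^ j)\<^sup>2 - 1 = 2 * e + e * e" by (simp add: e_def algebra_simps power2_eq_square)
      then show "\<not> n dvd 2 * e" using 2(2) ee by (metis dvd_add)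
      fix z :: int assume "\<not> 4 dvd z"
      then have "\<exists>i::nat. 4 dvd int i * z - 2"
        by (cases "even z") (rule exI[of _ 1] exI[of _ 2], simp, presburger)+
      then obtain i where "4 dvd int i * z - 2" ..
      then have "4 * e dvd (int i * z - 2) * e" by simp
      then have "n dvd int i * z * e - 2 * e" using e4 dvd_trans by (simp add: algebra_simps) blast
      then show "\<exists>k. n dvd u ^ k * z - (z + 2 * e)" by (intro red[OF ee]) (simp_all add: e_def)
    qed (use n4 e4' in auto)
  qed
qed

section \<open>Affine automorphisms of circulant graphs\<close>

locale cyclic_cayley = group G for G (structure) +
  fixes g :: 'a and S :: "'a set"
  assumes fin: "finite (carrier G)"
    and gen: "g \<in> carrier G" "carrier G = range (\<lambda>i::int. g [^] i)"
    and conn: "connection_set G S"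
begin

abbreviation A :: "('a \<Rightarrow> 'a) monoid" where "A \<equiv> Aut (Cay G S)"
abbreviation n :: int where "n \<equiv> int (ord g)"

text \<open>Integer exponents stand for residues modulo \<open>n\<close>, so \<open>u\<close> and
  \<open>b\<close> matter only modulo \<open>n\<close>.\<close>

definition acts_as :: "('a \<Rightarrow> 'a) \<Rightarrow> int \<Rightarrow> int \<Rightarrow> bool" where
  "acts_as f u b \<longleftrightarrow> (\<forall>i. f (g [^] i) = g [^] (u * i + b))"

lemma acts_asD: "acts_as f u b \<Longrightarrow> f (g [^] i) = g [^] (u * i + b)"
  by (simp add: acts_as_def)

lemma n_pos: "n > 0"
  using ord_ge_1[OF fin gen(1)] by simp

lemma pow_eq: "g [^] i = g [^] j \<longleftrightarrow> n dvd i - (j::int)"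
  using int_pow_eq[OF gen(1), of i j] by (simp add: dvd_diff_commute)

lemma pow_mult: "g [^] i \<otimes> g [^] j = g [^] (i + j :: int)"
  by (simp add: int_pow_mult gen(1))

lemma pow_mem [simp]: "g [^] (i::int) \<in> carrier G"
  by (simp add: gen)

lemma carrierE:
  assumes "x \<in> carrier G"
  obtains i :: int where "x = g [^] i"
  using assms gen(2) by auto

lemma group_A: "group A"
  by (rule group_Aut)

lemma fst_Cay [simp]: "fst (Cay G S) = carrier G"
  by (simp add: Cay_def)

lemma carrier_A: "carrier A = graph_auts (Cay G S)"
  by (simp add: Aut_def)

lemma A_Bij: "f \<in> carrier A \<Longrightarrow> f \<in> Bij (carrier G)"
  by (simp add: carrier_A graph_auts_def)

lemma A_mem: "f \<in> carrier A \<Longrightarrow> x \<in> carrier G \<Longrightarrow> f x \<in> carrier G"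
  using A_Bij Bij_imp_funcset by blast

lemma A_mult: "f \<in> carrier A \<Longrightarrow> h \<in> carrier A \<Longrightarrow> x \<in> carrier G \<Longrightarrow> (f \<otimes>\<^bsub>A\<^esub> h) x = f (h x)"
  using A_Bij[of f] A_Bij[of h] by (simp add: Aut_def BijGroup_def compose_eq)

lemma A_one: "x \<in> carrier G \<Longrightarrow> \<one>\<^bsub>A\<^esub> x = x"
  by (simp add: Aut_def BijGroup_def)

lemma A_eqI:
  assumes "f \<in> carrier A" "h \<in> carrier A" "\<And>i::int. f (g [^] i) = h (g [^] i)"
  shows "f = h"
proof (rule extensionalityI)
  show "f \<in> extensional (carrier G)" "h \<in> extensional (carrier G)"
    using assms A_Bij Bij_imp_extensional by blast+
  show "f x = h x" if "x \<in> carrier G" for x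
    using that assms(3) by (metis carrierE)
qed

lemma S_inv: "s \<in> S \<Longrightarrow> inv s \<in> S"
  using conn unfolding connection_set_def SET_INV_def by blast

text \<open>Inverse-closedness of \<open>S\<close> absorbs the two orientations of an edge, so
  adjacency depends only on the difference of exponents.\<close>

lemma edge_iff: "{g [^] i, g [^] j} \<in> snd (Cay G S) \<longleftrightarrow> g [^] (i - j :: int) \<in> S"
proof
  assume "{g [^] i, g [^] j} \<in> snd (Cay G S)"
  then obtain x s where xs: "{g [^] i, g [^] j} = {x, s \<otimes> x}" "x \<in> carrier G" "s \<in> S"
    by (auto simp: Cay_def)
  moreover have "s \<in> carrier G" using xs(3) conn by (auto simp: connection_set_def)
  ultimately obtain a c where x: "x = g [^] (a::int)" and s: "s = g [^] (c::int)"
    by (metis carrierE)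
  have "inv s = g [^] (- c)" by (simp add: s int_pow_neg gen(1))
  then have c: "g [^] c \<in> S" "g [^] (- c) \<in> S" using xs(3) S_inv[OF xs(3)] s by auto
  have "n dvd (i - j) - c \<or> n dvd (i - j) - (- c)"
  proof -
    have "(n dvd i - a \<and> n dvd j - (c + a)) \<or> (n dvd i - (c + a) \<and> n dvd j - a)"
      using xs(1) by (simp add: x s pow_mult doubleton_eq_iff pow_eq)
    moreover have "n dvd (i - j) - (- c)" if "n dvd i - a" "n dvd j - (c + a)"
      using dvd_diff[OF that] by (simp add: algebra_simps)
    moreover have "n dvd (i - j) - c" if "n dvd i - (c + a)" "n dvd j - a"
      using dvd_diff[OF that] by (simp add: algebra_simps)
    ultimately show ?thesis by blast
  qed
  then show "g [^] (i - j) \<in> S" using c by (metis pow_eq)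
next
  assume "g [^] (i - j) \<in> S"
  moreover have "g [^] i = g [^] (i - j) \<otimes> g [^] j" by (simp add: pow_mult)
  ultimately show "{g [^] i, g [^] j} \<in> snd (Cay G S)"
    unfolding Cay_def by (force simp: insert_commute)
qed

text \<open>Compare the pair of exponents \<open>i\<close>, \<open>0\<close> with its image: the
  translation part cancels in the difference.\<close>

lemma acts_as_S:
  assumes "f \<in> carrier A" "acts_as f u b"
  shows "g [^] i \<in> S \<longleftrightarrow> g [^] (u * i) \<in> S"
proof -
  have "{g [^] i, g [^] (0::int)} \<in> snd (Cay G S)
    \<longleftrightarrow> {f (g [^] i), f (g [^] (0::int))} \<in> snd (Cay G S)"
    using assms(1) pow_mem[of i] pow_mem[of 0]
    unfolding carrier_A graph_auts_def fst_Cay by blast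
  then show ?thesis by (simp only: acts_asD[OF assms(2)] edge_iff) simp
qed

text \<open>Conjugating translation by \<open>g\<close> gives translation by some
  \<open>g [^] u\<close>, hence \<open>f\<close> turns each increment of the exponent by 1 into an
  increment by \<open>u\<close>.\<close>

lemma right_regular_normal_acts_as:
  assumes "right_regular G \<lhd> A" "f \<in> carrier A"
  obtains u b where "acts_as f u b"
proof -
  interpret A: group A by (rule group_A)
  let ?\<tau> = "\<lambda>c. \<lambda>x\<in>carrier G. x \<otimes> c"
  have RR: "right_regular G \<subseteq> carrier A"
    using assms(1) by (simp add: normal_imp_subgroup subgroup.subset)
  have \<tau>: "?\<tau> g \<in> right_regular G" using gen(1) by (auto simp: right_regular_def)
  then have "f \<otimes>\<^bsub>A\<^esub> ?\<tau> g \<otimes>\<^bsub>A\<^esub> inv\<^bsub>A\<^esub> f \<in> right_regular G"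
    using assms by (simp add: A.normal_inv_iff)
  then obtain c where c: "c \<in> carrier G" "f \<otimes>\<^bsub>A\<^esub> ?\<tau> g \<otimes>\<^bsub>A\<^esub> inv\<^bsub>A\<^esub> f = ?\<tau> c"
    and c': "?\<tau> c \<in> carrier A"
    using RR unfolding right_regular_def by blast
  have \<tau>A: "?\<tau> g \<in> carrier A" using \<tau> RR by blast
  have conj: "f \<otimes>\<^bsub>A\<^esub> ?\<tau> g = ?\<tau> c \<otimes>\<^bsub>A\<^esub> f"
    unfolding c(2)[symmetric] using assms(2) \<tau>A by (simp add: A.m_assoc)
  obtain u where u: "c = g [^] (u::int)" using c(1) carrierE by blast
  have step: "f (g [^] (i + 1)) = f (g [^] i) \<otimes> g [^] u" for i :: int
  proof -
    have "f (?\<tau> g (g [^] i)) = ?\<tau> c (f (g [^] i))"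
      using arg_cong[OF conj, of "\<lambda>x. x (g [^] i)"]
      by (simp only: A_mult[OF assms(2) \<tau>A pow_mem] A_mult[OF c' assms(2) pow_mem])
    moreover have "g [^] i \<otimes> g = g [^] (i + 1)"
      using pow_mult[of i 1] gen(1) by simp
    ultimately show ?thesis using A_mem[OF assms(2)] by (simp add: u)
  qed
  obtain b where b: "f (g [^] (0::int)) = g [^] (b::int)"
    using A_mem[OF assms(2)] carrierE pow_mem by metis
  have "f (g [^] i) = g [^] (u * i + b)" for i
  proof (induction i rule: int_induct[where k = 0])
    case base
    show ?case using b by simp
  next
    case (step1 i)
    then show ?case using step[of i] by (simp add: pow_mult algebra_simps)
  next
    case (step2 i)
    obtain d where d: "f (g [^] (i - 1)) = g [^] (d::int)"
      using A_mem[OF assms(2)] carrierE pow_mem by metis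
    then have "n dvd (d + u) - (u * i + b)"
      using step[of "i - 1"] step2 by (simp add: pow_mult flip: pow_eq)
    then show ?case unfolding d pow_eq by (simp add: algebra_simps)
  qed
  then show thesis using that unfolding acts_as_def by blast
qed

text \<open>If \<open>S\<close> is stable under translation by \<open>t\<close> off the multiples of \<open>q\<close>, then translating only the
  residue class of \<open>2\<close> modulo \<open>q\<close> by \<open>t\<close> is an automorphism. It fixes the exponents \<open>0\<close> and \<open>1\<close> and
  moves \<open>2\<close>, so it is not affine.\<close>

lemma twist_not_affine:
  assumes q: "3 \<le> q" "q dvd n" "q dvd t" and t: "\<not> n dvd t"
    and S: "\<And>z. \<not> q dvd z \<Longrightarrow> g [^] z \<in> S \<longleftrightarrow> g [^] (z + t) \<in> S"
    and aff: "\<And>f. f \<in> carrier A \<Longrightarrow> \<exists>u b. acts_as f u b"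
  shows False
proof -
  define \<theta> where "\<theta> i = (if q dvd i - 2 then t else 0)" for i
  have \<theta>_q: "q dvd \<theta> i" for i using q(3) by (simp add: \<theta>_def)
  have \<theta>_cong: "\<theta> i = \<theta> j" if "q dvd i - j" for i j
    using that dvd_add_right_iff[of q "i - j" "j - 2"] by (simp add: \<theta>_def)
  \<comment> \<open>The chosen exponent is only a representative; the value does not depend on it
    because \<open>\<theta>\<close> is constant on classes modulo \<open>q\<close> and
    \<open>q\<close> divides \<open>n\<close>.\<close>
  define f where "f = (\<lambda>x\<in>carrier G. g [^] ((SOME i. g [^] i = x) + \<theta> (SOME i. g [^] i = x)))"
  have f: "f (g [^] i) = g [^] (i + \<theta> i)" for i
  proof -
    define j where "j = (SOME j::int. g [^] j = g [^] i)"
    have "g [^] j = g [^] i" unfolding j_def by (rule someI[of _ i]) (rule refl)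
    then have n: "n dvd j - i" by (simp add: pow_eq)
    then have "\<theta> j = \<theta> i" using q(2) \<theta>_cong dvd_trans by blast
    then have "g [^] (j + \<theta> j) = g [^] (i + \<theta> i)" using n by (simp add: pow_eq)
    then show ?thesis by (simp add: f_def j_def)
  qed
  have "inj_on f (carrier G)"
  proof (rule inj_onI)
    fix x y assume xy: "x \<in> carrier G" "y \<in> carrier G" "f x = f y"
    then obtain i j where ij: "x = g [^] (i::int)" "y = g [^] (j::int)" by (metis carrierE)
    then have n: "n dvd (i + \<theta> i) - (j + \<theta> j)" using xy(3) f by (simp add: pow_eq)
    \<comment> \<open>Shifts are multiples of \<open>q\<close>, so the class modulo
      \<open>q\<close>, and with it the shift itself, can be recovered from the image.\<close>
    then have "q dvd (i + \<theta> i) - (j + \<theta> j)" using q(2) dvd_trans by blast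
    moreover have "i - j = (i + \<theta> i) - (j + \<theta> j) - (\<theta> i - \<theta> j)" by simp
    ultimately have "q dvd i - j" by (metis \<theta>_q dvd_diff)
    then show "x = y" using n \<theta>_cong[of i j] by (simp add: ij pow_eq)
  qed
  moreover have "f ` carrier G \<subseteq> carrier G"
    by (auto simp: f elim!: carrierE)
  ultimately have "bij_betw f (carrier G) (carrier G)"
    using fin by (simp add: bij_betw_def endo_inj_surj)
  then have "f \<in> Bij (carrier G)" by (simp add: Bij_def f_def)
  moreover have "{x, y} \<in> snd (Cay G S) \<longleftrightarrow> {f x, f y} \<in> snd (Cay G S)"
    if xy: "x \<in> carrier G" "y \<in> carrier G" for x y
  proof -
    obtain i j where ij: "x = g [^] (i::int)" "y = g [^] (j::int)" using xy by (metis carrierE)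
    have "g [^] (i - j) \<in> S \<longleftrightarrow> g [^] ((i + \<theta> i) - (j + \<theta> j)) \<in> S"
    proof (cases "q dvd i - j")
      case True
      then show ?thesis using \<theta>_cong[of i j] by simp
    next
      case False
      have "\<theta> i - \<theta> j = 0 \<or> \<theta> i - \<theta> j = t \<or> \<theta> i - \<theta> j = - t" by (simp add: \<theta>_def)
      moreover have "\<not> q dvd i - j - t" using False q(3) by (simp add: dvd_diff_left_iff)
      then have "g [^] (i - j - t) \<in> S \<longleftrightarrow> g [^] (i - j) \<in> S" using S by fastforce
      moreover have "(i + \<theta> i) - (j + \<theta> j) = i - j + (\<theta> i - \<theta> j)" by simp
      ultimately show ?thesis using S[OF False] by (metis add.right_neutral diff_conv_add_uminus)
    qed
    then show ?thesis by (simp add: ij f edge_iff)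
  qed
  ultimately have "f \<in> carrier A" by (simp add: carrier_A graph_auts_def)
  then obtain u b where "acts_as f u b" using aff by blast
  then have "n dvd (i + \<theta> i) - (u * i + b)" for i
    using f[of i] by (metis acts_asD pow_eq)
  \<comment> \<open>As \<open>q\<close> is at least 3, neither 0 nor 1 lies in the class of
    2.\<close>
  moreover have "\<not> q dvd -2" "\<not> q dvd -1"
    using q(1) zdvd_imp_le[of q 2] zdvd_imp_le[of q 1] by auto
  then have "\<theta> 0 = 0" "\<theta> 1 = 0" "\<theta> 2 = t" by (simp_all add: \<theta>_def)
  ultimately have z: "n dvd 0 - b" "n dvd 1 - (u + b)" "n dvd (2 + t) - (u * 2 + b)"
    by (metis add.right_neutral mult_zero_right add_0, metis add.right_neutral mult.right_neutral, metis)
  \<comment> \<open>The second difference at 0, 1, 2 vanishes for an affine map, but equals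
    \<open>t\<close> for \<open>f\<close>.\<close>
  have "n dvd ((2 + t) - (u * 2 + b)) - 2 * (1 - (u + b)) + (0 - b)"
    by (rule dvd_add[OF dvd_diff[OF z(3) dvd_mult[OF z(2)]] z(1)])
  then show False using t by (simp add: algebra_simps)
qed

end

section \<open>Transitive cyclic groups generated by an affine permutation\<close>

locale cyclic_cayley_regular = cyclic_cayley +
  fixes H h u b
  assumes aff: "\<And>f. f \<in> carrier A \<Longrightarrow> \<exists>u b. acts_as f u b"
    and H: "subgroup H A" "H = range (\<lambda>k::nat. h [^]\<^bsub>A\<^esub> k)" "h \<in> H"
    and trans: "\<And>x y. x \<in> carrier G \<Longrightarrow> y \<in> carrier G \<Longrightarrow> \<exists>f\<in>H. f x = y"
    and h: "acts_as h u b"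
begin

lemma h_A: "h \<in> carrier A" "h [^]\<^bsub>A\<^esub> (k::nat) \<in> carrier A"
  using H subgroup.subset by blast+

lemma trans_pow:
  obtains k :: nat where "(h [^]\<^bsub>A\<^esub> k) (g [^] (i::int)) = g [^] (j::int)"
  using trans[of "g [^] i" "g [^] j"] H(2) by auto

lemma acts_as_pow: "acts_as (h [^]\<^bsub>A\<^esub> k) (u ^ k) (b * (\<Sum>j<k. u ^ j))"
proof (induction k)
  case 0
  show ?case by (simp add: acts_as_def A_one)
next
  case (Suc k)
  show ?case
    unfolding acts_as_def
    by (auto simp: A_mult h_A acts_asD[OF h] acts_asD[OF Suc] algebra_simps)
qed

text \<open>Transitivity as an induction principle: a nonempty set of residues invariant under the
  generator is everything. It is used to refute proper invariant sets.\<close>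

lemma orbit_closed:
  assumes "P x" and step: "\<And>i. P i \<Longrightarrow> P (u * i + b)"
    and cong: "\<And>i j. n dvd i - j \<Longrightarrow> P i \<Longrightarrow> P j"
  shows "P (y::int)"
proof -
  interpret A: group A by (rule group_A)
  have "\<exists>i. P i \<and> (h [^]\<^bsub>A\<^esub> k) (g [^] x) = g [^] i" for k :: nat
  proof (induction k)
    case 0
    show ?case using assms(1) by (auto simp: A_one)
  next
    case (Suc k)
    then obtain i where i: "P i" "(h [^]\<^bsub>A\<^esub> k) (g [^] x) = g [^] i" by blast
    \<comment> \<open>Powers are defined with the new factor on the right, whereas here
      \<open>h\<close> must be applied last.\<close>
    have "h [^]\<^bsub>A\<^esub> Suc k = h \<otimes>\<^bsub>A\<^esub> h [^]\<^bsub>A\<^esub> k"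
      by (rule A.nat_pow_Suc2) (rule h_A)
    then have "(h [^]\<^bsub>A\<^esub> Suc k) (g [^] x) = g [^] (u * i + b)"
      by (simp only: A_mult h_A pow_mem i acts_asD[OF h])
    then show ?case using step[OF i(1)] by blast
  qed
  then show ?thesis using cong by (metis trans_pow pow_eq)
qed

text \<open>Each failure of the condition yields a proper invariant set of residues, modulo
  \<open>r\<close> or modulo 4 or 2.\<close>

lemma hull_dobell_u: "hull_dobell n u"
proof -
  have prime: "r dvd u - 1" if r: "prime r" "r dvd n" for r
  proof (rule ccontr)
    assume "\<not> r dvd u - 1"
    then have "coprime r (u - 1)" using r(1) by (simp add: prime_imp_coprime)
    then obtain y x where xy: "y * r + x * (u - 1) = 1"
      using bezout_int[of r "u - 1"] by auto
    \<comment> \<open>If \<open>u - 1\<close> is invertible modulo \<open>r\<close> with inverse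
      \<open>x\<close>, then \<open>- b * x\<close> is a fixed point of the generator modulo
      \<open>r\<close>, so its class is invariant and misses the next one.\<close>
    have fix_pt: "(u - 1) * (- b * x) + b = b * y * r"
    proof -
      have "(u - 1) * (- b * x) + b = b * (1 - x * (u - 1))" by (simp add: algebra_simps)
      also have "1 - x * (u - 1) = y * r" using xy by simp
      finally show ?thesis by simp
    qed
    have "r dvd (- b * x + 1) - (- b * x)"
    proof (rule orbit_closed[where P = "\<lambda>i. r dvd i - (- b * x)"])
      show "r dvd - b * x - (- b * x)" by simp
      fix i j
      show "r dvd u * i + b - (- b * x)" if "r dvd i - (- b * x)"
      proof -
        have "u * i + b - (- b * x) = u * (i - (- b * x)) + ((u - 1) * (- b * x) + b)"
          by (simp add: algebra_simps)
        then show ?thesis using that unfolding fix_pt by simp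
      qed
      show "r dvd j - (- b * x)" if "n dvd i - j" "r dvd i - (- b * x)"
        using dvd_diff[OF that(2) dvd_trans[OF r(2) that(1)]] by (simp add: add.commute)
    qed
    then show False using r(1) not_prime_unit by auto
  qed
  moreover have "4 dvd u - 1" if n4: "4 dvd n"
  proof (rule ccontr)
    assume u4: "\<not> 4 dvd u - 1"
    have n2: "2 dvd n" using n4 dvd_trans[of 2 4 n] by simp
    have "2 dvd u - 1" using prime[of 2] n2 by simp
    then have u: "4 dvd u + 1" using u4 by presburger
    \<comment> \<open>For \<open>u\<close> congruent to -1 modulo 4 the generator swaps the classes
      of 0 and \<open>b\<close>. The class of 2 must be among them, so \<open>b\<close> is even, and
      then the even residues are invariant.\<close>
    have "4 dvd (2::int) \<or> 4 dvd 2 - b"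
    proof (rule orbit_closed[where P = "\<lambda>i. 4 dvd i \<or> 4 dvd i - b"])
      show "4 dvd (0::int) \<or> 4 dvd 0 - b" by simp
      fix i j
      show "4 dvd u * i + b \<or> 4 dvd u * i + b - b" if "4 dvd i \<or> 4 dvd i - b"
      proof -
        have "4 dvd u * i + b" if "4 dvd i - b"
        proof -
          have "u * i + b = u * (i - b) + (u + 1) * b" by (simp add: algebra_simps)
          then show ?thesis using that u by simp
        qed
        then show ?thesis using that by auto
      qed
      show "4 dvd j \<or> 4 dvd j - b" if "n dvd i - j" "4 dvd i \<or> 4 dvd i - b"
        using dvd_trans[OF n4 that(1)] that(2) by presburger
    qed
    then have "even b" by presburger
    have "2 dvd (1::int)"
    proof (rule orbit_closed[where P = even])
      show "even (u * i + b)" if "even i" for i using that \<open>even b\<close> by simp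
      show "even j" if "n dvd i - j" "even i" for i j
        using dvd_trans[OF n2 that(1)] that(2) by presburger
    qed auto
    then show False by simp
  qed
  ultimately show ?thesis unfolding hull_dobell_def by blast
qed

lemma odd_b:
  assumes "even n"
  shows "odd b"
proof
  assume b: "even b"
  have "even (1::int)"
  proof (rule orbit_closed[where P = even])
    show "even (u * i + b)" if "even i" for i using that b by simp
    show "even j" if "n dvd i - j" "even i" for i j
      using dvd_trans[OF assms that(1)] that(2) by presburger
  qed auto
  then show False by simp
qed

text \<open>The generator has finite order; subtracting its trivial power at exponents 1 and 0
  removes the translation part.\<close>

lemma power_u_eq_1: "\<exists>M>0. n dvd u ^ M - 1"
proof -
  interpret A: group A by (rule group_A)
  have "carrier A \<subseteq> carrier G \<rightarrow>\<^sub>E carrier G"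
    unfolding PiE_def using A_Bij Bij_imp_extensional Bij_imp_funcset by blast
  then have finA: "finite (carrier A)"
    using fin by (meson finite_PiE finite_subset)
  define M where "M = A.ord h"
  have "M > 0" using A.ord_ge_1[OF finA h_A(1)] by (simp add: M_def)
  have "h [^]\<^bsub>A\<^esub> M = \<one>\<^bsub>A\<^esub>" using h_A(1) by (simp add: M_def)
  then have "n dvd (u ^ M * i + b * (\<Sum>j<M. u ^ j)) - i" for i
    using acts_asD[OF acts_as_pow[of M], of i] by (simp add: A_one pow_eq dvd_diff_commute)
  from dvd_diff[OF this[of 1] this[of 0]] have "n dvd u ^ M - 1"
    by (simp add: algebra_simps)
  then show ?thesis using \<open>M > 0\<close> by blast
qed

text \<open>Powers of \<open>h\<close> make \<open>S\<close> stable under multiplication by powers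
  of \<open>u\<close>. Otherwise the orbits would yield the translation stability that produces a
  non-affine automorphism.\<close>

lemma u_square: "n dvd u\<^sup>2 - 1"
proof (rule ccontr)
  assume nd: "\<not> n dvd u\<^sup>2 - 1"
  obtain M where M: "M > 0" "n dvd u ^ M - 1" using power_u_eq_1 by blast
  have "n \<noteq> 0" using n_pos by simp
  then obtain q t where qt: "3 \<le> q" "q dvd n" "q dvd t" "\<not> n dvd t"
    and orb: "\<And>z. \<not> q dvd z \<Longrightarrow> \<exists>k::nat. n dvd u ^ k * z - (z + t)"
    using hull_dobell_orbits[OF _ hull_dobell_u M nd] by blast
  have "g [^] z \<in> S \<longleftrightarrow> g [^] (z + t) \<in> S" if "\<not> q dvd z" for z
    using orb[OF that] acts_as_S[OF h_A(2) acts_as_pow] by (metis pow_eq)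
  then show False using twist_not_affine[OF qt] aff by blast
qed

text \<open>All powers of \<open>h\<close> have linear part 1 and so are translations; transitivity
  at exponent 0 supplies every translation.\<close>

lemma H_eq_right_regular:
  assumes RR: "right_regular G \<subseteq> carrier A" and u: "n dvd u - 1"
  shows "H = right_regular G"
proof -
  have pw: "h [^]\<^bsub>A\<^esub> k = (\<lambda>x\<in>carrier G. x \<otimes> g [^] c)"
    if "(h [^]\<^bsub>A\<^esub> k) (g [^] (0::int)) = g [^] (c::int)" for k :: nat and c
  proof (rule A_eqI)
    show "h [^]\<^bsub>A\<^esub> k \<in> carrier A" by (rule h_A)
    show "(\<lambda>x\<in>carrier G. x \<otimes> g [^] c) \<in> carrier A"
      using RR by (auto simp: right_regular_def)
    fix i :: int
    let ?s = "b * (\<Sum>j<k. u ^ j)"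
    have "u - 1 dvd u ^ k - 1" by (metis dvd_triv_left power_diff_1_eq)
    then have uk: "n dvd (u ^ k - 1) * i" using u dvd_trans by (blast intro: dvd_mult2)
    have s: "n dvd ?s - c"
      using that acts_asD[OF acts_as_pow, of k 0] by (simp add: pow_eq dvd_diff_commute)
    have "n dvd (u ^ k * i + ?s) - (i + c)"
      using dvd_add[OF uk s] by (simp add: algebra_simps)
    then show "(h [^]\<^bsub>A\<^esub> k) (g [^] i) = (\<lambda>x\<in>carrier G. x \<otimes> g [^] c) (g [^] i)"
      by (simp add: acts_asD[OF acts_as_pow] pow_mult pow_eq)
  qed
  show ?thesis
  proof
    show "H \<subseteq> right_regular G"
    proof
      fix f assume "f \<in> H"
      then obtain k :: nat where k: "f = h [^]\<^bsub>A\<^esub> k" using H(2) by blast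
      have "f = (\<lambda>x\<in>carrier G. x \<otimes> g [^] (b * (\<Sum>j<k. u ^ j)))"
        unfolding k by (rule pw) (simp add: acts_asD[OF acts_as_pow, of k 0, simplified])
      then show "f \<in> right_regular G" unfolding right_regular_def using pow_mem by blast
    qed
    show "right_regular G \<subseteq> H"
    proof
      fix f assume "f \<in> right_regular G"
      then obtain c :: int where c: "f = (\<lambda>x\<in>carrier G. x \<otimes> g [^] c)"
        unfolding right_regular_def using carrierE by blast
      obtain k :: nat where "(h [^]\<^bsub>A\<^esub> k) (g [^] (0::int)) = g [^] c" by (rule trans_pow)
      then show "f \<in> H" using pw c H(2) by auto
    qed
  qed
qed

text \<open>As \<open>u\<^sup>2 = 1\<close>, the linear part of an element of \<open>H\<close> is determined by the parity of its translation
  part, and conjugation by an affine map preserves both.\<close>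

lemma H_normal:
  assumes n2: "even n"
  shows "H \<lhd> A"
proof -
  interpret A: group A by (rule group_A)
  have "prime (2::int)" by simp
  then have "2 dvd u - 1" using hull_dobell_u n2 unfolding hull_dobell_def by blast
  then have "odd u" by simp
  \<comment> \<open>Each summand \<open>b * u ^ j\<close> is odd, so the translation part of the
    \<open>k\<close>-th power has the parity of \<open>k\<close>.\<close>
  have par: "even (b * (\<Sum>j<k. u ^ j)) \<longleftrightarrow> even k" for k
    by (induction k) (use odd_b[OF n2] \<open>odd u\<close> in auto)
  have uk: "n dvd u ^ k - u ^ l" if "even k \<longleftrightarrow> even l" for k l
  proof -
    have "n dvd u ^ k - u ^ (k mod 2)" for k
    proof -
      have "u\<^sup>2 - 1 dvd (u\<^sup>2) ^ (k div 2) - 1" by (metis dvd_triv_left power_diff_1_eq)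
      then have "n dvd ((u\<^sup>2) ^ (k div 2) - 1) * u ^ (k mod 2)"
        using u_square dvd_trans by (blast intro: dvd_mult2)
      also have "\<dots> = u ^ (2 * (k div 2) + k mod 2) - u ^ (k mod 2)"
        by (simp only: power_add power_mult) (simp add: algebra_simps)
      finally show ?thesis by simp
    qed
    moreover have "k mod 2 = l mod 2" using that by (simp add: mod2_eq_if)
    ultimately have "n dvd (u ^ k - u ^ (k mod 2)) - (u ^ l - u ^ (k mod 2))"
      by (metis dvd_diff)
    then show ?thesis by simp
  qed
  have "f \<otimes>\<^bsub>A\<^esub> x \<otimes>\<^bsub>A\<^esub> inv\<^bsub>A\<^esub> f \<in> H" if f: "f \<in> carrier A" and x: "x \<in> H" for f x
  proof -
    obtain k :: nat where k: "x = h [^]\<^bsub>A\<^esub> k" using x H(2) by blast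
    have xA: "x \<in> carrier A" unfolding k by (rule h_A)
    define y where "y = f \<otimes>\<^bsub>A\<^esub> x \<otimes>\<^bsub>A\<^esub> inv\<^bsub>A\<^esub> f"
    have yA: "y \<in> carrier A" using f xA by (simp add: y_def)
    have yf: "y \<otimes>\<^bsub>A\<^esub> f = f \<otimes>\<^bsub>A\<^esub> x" using f xA by (simp add: y_def A.m_assoc)
    obtain v a where va: "acts_as f v a" using aff f by blast
    obtain w c where wc: "acts_as y w c" using aff yA by blast
    let ?s = "\<lambda>k. b * (\<Sum>j<k. u ^ j)"
    have eq: "n dvd (w * (v * i + a) + c) - (v * (u ^ k * i + ?s k) + a)" for i
    proof -
      have "y (f (g [^] i)) = f (x (g [^] i))"
        using yf yA f xA by (metis A_mult pow_mem)
      then show ?thesis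
        by (simp add: k acts_asD[OF va] acts_asD[OF wc] acts_asD[OF acts_as_pow] pow_eq)
    qed
    \<comment> \<open>Surjectivity of \<open>f\<close> makes its linear part invertible: a preimage
      of exponent \<open>1 + a\<close> is the inverse.\<close>
    obtain v' where v': "n dvd v * v' - 1"
    proof -
      have "bij_betw f (carrier G) (carrier G)" using A_Bij[OF f] by (simp add: Bij_def)
      then obtain z where "z \<in> carrier G" "f z = g [^] (1 + a)"
        using pow_mem by (metis bij_betw_def imageE)
      then obtain i where "f (g [^] (i::int)) = g [^] (1 + a)" by (metis carrierE)
      then show thesis using that[of i] by (simp add: acts_asD[OF va] pow_eq)
    qed
    have wu: "n dvd w - u ^ k"
    proof -
      have "n dvd (w - u ^ k) * v"
        using dvd_diff[OF eq[of 1] eq[of 0]] by (simp add: algebra_simps)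
      then have "n dvd (w - u ^ k) * v * v' - (w - u ^ k) * (v * v' - 1)"
        using v' by (intro dvd_diff) auto
      then show ?thesis by (simp add: algebra_simps)
    qed
    have "even c \<longleftrightarrow> even k"
    proof -
      have "odd v" using dvd_trans[OF n2 v'] by auto
      moreover have "odd w" using dvd_trans[OF n2 wu] \<open>odd u\<close> by auto
      moreover have "even ((w * a + c) - (v * ?s k + a))" using dvd_trans[OF n2 eq[of 0]] by simp
      ultimately show ?thesis using par[of k] by auto
    qed
    \<comment> \<open>The candidate for the conjugate is the power of \<open>h\<close> with the same
      translation part \<open>c\<close>; parity then forces the linear parts to agree.\<close>
    obtain l :: nat where l: "(h [^]\<^bsub>A\<^esub> l) (g [^] (0::int)) = g [^] c" by (rule trans_pow)
    then have lc: "n dvd ?s l - c"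
      using acts_asD[OF acts_as_pow, of l 0] by (simp add: pow_eq dvd_diff_commute)
    then have "even l \<longleftrightarrow> even c" using dvd_trans[OF n2 lc] par[of l] by auto
    with \<open>even c \<longleftrightarrow> even k\<close> have lk: "n dvd u ^ l - u ^ k" using uk by blast
    have "y = h [^]\<^bsub>A\<^esub> l"
    proof (rule A_eqI[OF yA h_A(2)])
      fix i :: int
      have "n dvd (w - u ^ k) * i - (u ^ l - u ^ k) * i - (?s l - c)"
        by (rule dvd_diff[OF dvd_diff[OF dvd_mult2[OF wu] dvd_mult2[OF lk]] lc])
      then show "y (g [^] i) = (h [^]\<^bsub>A\<^esub> l) (g [^] i)"
        by (simp add: acts_asD[OF wc] acts_asD[OF acts_as_pow] pow_eq algebra_simps)
    qed
    then show ?thesis unfolding y_def[symmetric] H(2) by (rule range_eqI)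
  qed
  then show ?thesis using H(1) by (simp add: A.normal_inv_iff)
qed

end

section \<open>Contradiction for a cyclic group with an NNN-graph\<close>

theorem theorem1p3:
  fixes G :: "('a, 'b) monoid_scheme"
  assumes "group G" and "finite (carrier G)" and "cyclic_group G"
  shows "\<not> NNN_property G"
proof
  assume "NNN_property G"
  then obtain S H where S: "connection_set G S"
    and norm: "right_regular G \<lhd> Aut (Cay G S)"
    and iso: "Aut (Cay G S)\<lparr>carrier := H\<rparr> \<cong> G"
    and ne: "H \<noteq> right_regular G"
    and reg: "regular_subgroup H (Cay G S)"
    and nn: "\<not> H \<lhd> Aut (Cay G S)"
    unfolding NNN_property_def NNN_graph_def normal_for_def non_normal_for_def by blast
  interpret group G by (rule assms(1))
  obtain g where g: "g \<in> carrier G" "carrier G = range (\<lambda>i::int. g [^]\<^bsub>G\<^esub> i)"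
    using assms(3) cyclic_group by blast
  interpret cyclic_cayley G g S
    by unfold_locales (use assms(2) g S in auto)
  have H: "subgroup H A" using reg by (simp add: regular_subgroup_def)
  interpret A: group A by (rule group_A)
  interpret AH: group "A\<lparr>carrier := H\<rparr>" using H by (rule A.subgroup_imp_group)
  have "cyclic_group (A\<lparr>carrier := H\<rparr>)"
    using isomorphic_group_cyclicity[OF iso AH.is_group assms(1)] assms(3) by blast
  then obtain h where h: "h \<in> H" "H = range (\<lambda>i::int. h [^]\<^bsub>A\<lparr>carrier := H\<rparr>\<^esub> i)"
    using AH.cyclic_group by auto
  have finH: "finite (carrier (A\<lparr>carrier := H\<rparr>))"
    using iso assms(2) unfolding is_iso_def iso_def by (auto simp: bij_betw_finite)
  \<comment> \<open>Finiteness lets natural exponents replace integer ones, as needed for induction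
    along the orbit.\<close>
  have H_pow: "H = range (\<lambda>k::nat. h [^]\<^bsub>A\<^esub> k)"
  proof -
    have "H = generate (A\<lparr>carrier := H\<rparr>) {h}"
      using h AH.generate_pow[of h] by auto
    also have "\<dots> = range (\<lambda>k::nat. h [^]\<^bsub>A\<lparr>carrier := H\<rparr>\<^esub> k)"
      using AH.generate_pow_on_finite_carrier[OF finH, of h] h(1) by auto
    finally show ?thesis by (simp only: A.nat_pow_consistent[symmetric])
  qed
  have aff: "\<exists>u b. acts_as f u b" if "f \<in> carrier A" for f
    by (rule right_regular_normal_acts_as[OF norm that]) blast
  obtain u b where hub: "acts_as h u b" using aff[of h] h(1) subgroup.subset[OF H] by blast
  have trans: "\<exists>f\<in>H. f x = y" if "x \<in> carrier G" "y \<in> carrier G" for x y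
    using reg that transitive_action.unique_orbit[of "A\<lparr>carrier := H\<rparr>" "carrier G" "\<lambda>h. h" x y]
    by (simp add: regular_subgroup_def)
  interpret cyclic_cayley_regular G g S H h u b
    by (intro cyclic_cayley_regular.intro cyclic_cayley_axioms cyclic_cayley_regular_axioms.intro
        aff H H_pow h(1) trans hub)
  have "\<not> n dvd u - 1"
    using H_eq_right_regular ne norm normal_imp_subgroup subgroup.subset by blast
  moreover have "n \<noteq> 0" using n_pos by simp
  \<comment> \<open>A square root of 1 satisfying \<open>hull_dobell\<close> but different from 1
    modulo \<open>n\<close> exists only if 4 divides \<open>n\<close>; the resulting evenness makes
    \<open>H\<close> normal.\<close>
  ultimately have "4 dvd n" using hull_dobell_square(2)[OF _ hull_dobell_u u_square] by blast
  then have "even n" using dvd_trans[of 2 4 n] by simp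
  then show False using H_normal nn by blast
qed

end
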